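(* Let $H$ be a positive integer and $H_0>H_1>\dots>H_{r-1}$ positive integers with $H_0=H$, $H_{r-1}=1$ and $H_{k+1}$ dividing $H_k$ for all $k$. Let $R_1,\dots,R_n$ be rectangles, $R_i$ having positive integer width $\ell_i$ and height $h_i\in\{H_0,\dots,H_{r-1}\}$. If there exists a feasible height-divisible packing of these rectangles into a bin of width $\ell$ and height $H$, then there exists a feasible height-divisible packing of them into a bin of width $\ell$ and height $H$ that is in canonical form.
   Context: A packing assigns to each $R_i$ integer bottom-left coordinates $(x_i,y_i)$. It is feasible (for a bin of width $\ell$ and height $H$) if $x_i\ge0$, $y_i\ge 0$, $x_i+\ell_i\le \ell$, $y_i+h_i\le H$ for all $i$, and no two distinct rectangles overlap, where $R_i,R_j$ overlap if $x_i-\ell_j<x_j<x_i+\ell_i$ and $y_i-h_j<y_j<y_i+h_i$. It is height-divisible if $y_i$ is divisible by $h_i$ for every $i$. A height-divisible packing is in canonical form if for all $i,j\in\{1,\dots,n\}$: whenever $h_i>h_j$, $y_j\ge y_i$ and $y_j+h_j\le y_i+h_i$, we have $x_i+\ell_i\le x_j$. *)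

theory Defs
  imports Main
begin

text \<open>
  The rectangles are indexed by \<open>{1..n}\<close>; rectangle \<open>i\<close> has width \<open>w i\<close>, height \<open>h i\<close> and
  bottom-left corner \<open>(x i, y i)\<close>. The bin has width \<open>L\<close> and height \<open>H\<close>. Values of
  \<open>w\<close>, \<open>h\<close>, \<open>x\<close>, \<open>y\<close> outside \<open>{1..n}\<close> are irrelevant.
\<close>

definition rect_overlap ::
  "(nat \<Rightarrow> int) \<Rightarrow> (nat \<Rightarrow> int) \<Rightarrow> (nat \<Rightarrow> int) \<Rightarrow> (nat \<Rightarrow> int) \<Rightarrow> nat \<Rightarrow> nat \<Rightarrow> bool" where
  "rect_overlap w h x y i j \<longleftrightarrow>
     x i - w j < x j \<and> x j < x i + w i \<and> y i - h j < y j \<and> y j < y i + h i"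

definition feasible_packing ::
  "nat \<Rightarrow> (nat \<Rightarrow> int) \<Rightarrow> (nat \<Rightarrow> int) \<Rightarrow> int \<Rightarrow> int \<Rightarrow> (nat \<Rightarrow> int) \<Rightarrow> (nat \<Rightarrow> int) \<Rightarrow> bool" where
  "feasible_packing n w h L H x y \<longleftrightarrow>
     (\<forall>i\<in>{1..n}. x i \<ge> 0 \<and> y i \<ge> 0 \<and> x i + w i \<le> L \<and> y i + h i \<le> H) \<and>
     (\<forall>i\<in>{1..n}. \<forall>j\<in>{1..n}. i \<noteq> j \<longrightarrow> \<not> rect_overlap w h x y i j)"

definition height_divisible :: "nat \<Rightarrow> (nat \<Rightarrow> int) \<Rightarrow> (nat \<Rightarrow> int) \<Rightarrow> bool" where
  "height_divisible n h y \<longleftrightarrow> (\<forall>i\<in>{1..n}. h i dvd y i)"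

definition canonical_form ::
  "nat \<Rightarrow> (nat \<Rightarrow> int) \<Rightarrow> (nat \<Rightarrow> int) \<Rightarrow> (nat \<Rightarrow> int) \<Rightarrow> (nat \<Rightarrow> int) \<Rightarrow> bool" where
  "canonical_form n w h x y \<longleftrightarrow>
     (\<forall>i\<in>{1..n}. \<forall>j\<in>{1..n}.
        h i > h j \<and> y j \<ge> y i \<and> y j + h j \<le> y i + h i \<longrightarrow> x i + w i \<le> x j)"

end

theory Submission
  imports Defs
begin

text \<open>
  By divisibility the vertical ranges of two rectangles are nested or disjoint. Keep all
  \<open>y\<close>-coordinates, and push each rectangle to the right of all rectangles whose range
  contains its own, ties broken by index. These, together with the rectangle itself, all meet
  the row just above its bottom edge, so in the given packing they are disjoint there and
  their total width is at most \<open>L\<close>.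
\<close>

lemma dvd_if_le_in_divisor_chain:
  fixes Hs :: "nat \<Rightarrow> int"
  assumes pos: "\<forall>k<r. Hs k > 0"
    and dvd: "\<forall>k. k + 1 < r \<longrightarrow> Hs (k + 1) dvd Hs k"
    and a: "a \<in> Hs ` {..<r}" and b: "b \<in> Hs ` {..<r}" and le: "a \<le> b"
  shows "a dvd b"
proof -
  have chain: "Hs m dvd Hs k" if "k \<le> m" "m < r" for k m
    using that
  proof (induction m rule: dec_induct)
    case (step m)
    then show ?case
      using dvd by (metis Suc_eq_plus1 Suc_lessD dvd_trans)
  qed simp
  obtain k m where k: "a = Hs k" "k < r" and m: "b = Hs m" "m < r"
    using a b by auto
  show ?thesis
  proof (cases "m \<le> k")
    case True
    then show ?thesis using chain k m by simp
  next
    case False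
    \<comment> \<open>Here the chain yields divisibility in the wrong direction. Since
      \<open>a\<close> is positive, this gives \<open>b\<close> \<le> \<open>a\<close>, so the two
      values coincide.\<close>
    then have "b dvd a" using chain k m by simp
    then have "b \<le> a" using k pos by (simp add: zdvd_imp_le)
    then show ?thesis using le by simp
  qed
qed

text \<open>All four endpoints are multiples of \<open>b\<close>. Measured in units of
  \<open>b\<close>, the strict inequalities expressing that the intervals meet are between integers,
  so each sharpens by one unit to a containment bound.\<close>

lemma aligned_intervals_nested:
  fixes a b p q :: int
  assumes "b > 0" "b dvd a" "a dvd p" "b dvd q" "p < q + b" "q < p + a"
  shows "p \<le> q" "q + b \<le> p + a"
proof -
  have "b dvd p" using assms dvd_trans by blast
  then obtain m s t where m: "a = b * m" and s: "p = b * s" and t: "q = b * t"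
    using assms by (auto elim!: dvdE)
  have "b * s < b * (t + 1)" "b * t < b * (s + m)"
    using assms m s t by (simp_all add: algebra_simps)
  then have "s \<le> t" "t + 1 \<le> s + m"
    using \<open>b > 0\<close> by simp_all
  then have "b * s \<le> b * t" "b * (t + 1) \<le> b * (s + m)"
    using \<open>b > 0\<close> by simp_all
  then show "p \<le> q" "q + b \<le> p + a"
    using m s t by (simp_all add: algebra_simps)
qed

text \<open>Count integer points: half-open intervals contain exactly as many as their width, and
  all of them lie in \<open>{0..<L}\<close>.\<close>

lemma sum_width_disjoint_intervals_le:
  fixes x w :: "'a \<Rightarrow> int"
  assumes "finite S" "L \<ge> 0"
    and bounds: "\<And>i. i \<in> S \<Longrightarrow> 0 \<le> x i \<and> 0 \<le> w i \<and> x i + w i \<le> L"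
    and disj: "\<And>i j. i \<in> S \<Longrightarrow> j \<in> S \<Longrightarrow> i \<noteq> j \<Longrightarrow> x i + w i \<le> x j \<or> x j + w j \<le> x i"
  shows "sum w S \<le> L"
proof -
  have "card (\<Union>i\<in>S. {x i..<x i + w i}) = (\<Sum>i\<in>S. card {x i..<x i + w i})"
    using \<open>finite S\<close> disj by (intro card_UN_disjoint) fastforce+
  moreover have "card (\<Union>i\<in>S. {x i..<x i + w i}) \<le> card {0..<L}"
    using bounds by (intro card_mono) fastforce+
  ultimately have "(\<Sum>i\<in>S. nat (w i)) \<le> nat L"
    by simp
  then have "int (\<Sum>i\<in>S. nat (w i)) \<le> L"
    using \<open>L \<ge> 0\<close> by linarith
  moreover have "int (\<Sum>i\<in>S. nat (w i)) = sum w S"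
    unfolding of_nat_sum using bounds by (intro sum.cong) auto
  ultimately show ?thesis by simp
qed

theorem theorem2:
  fixes n r :: nat
    and H L :: int
    and Hs :: "nat \<Rightarrow> int"
    and w h :: "nat \<Rightarrow> int"
  assumes "H > 0"
    and "r \<ge> 1"
    and "\<forall>k<r. Hs k > 0"
    and "\<forall>k. k + 1 < r \<longrightarrow> Hs k > Hs (k + 1)"
    and "Hs 0 = H"
    and "Hs (r - 1) = 1"
    and "\<forall>k. k + 1 < r \<longrightarrow> Hs (k + 1) dvd Hs k"
    and "\<forall>i\<in>{1..n}. w i > 0"
    and "\<forall>i\<in>{1..n}. h i \<in> Hs ` {..<r}"
    and "\<exists>x y. feasible_packing n w h L H x y \<and> height_divisible n h y"
  shows "\<exists>x y. feasible_packing n w h L H x y \<and> height_divisible n h y \<and>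
           canonical_form n w h x y"
proof -
  obtain x y where feas: "feasible_packing n w h L H x y" and hd: "height_divisible n h y"
    using assms by blast
  have bd: "x i \<ge> 0 \<and> y i \<ge> 0 \<and> x i + w i \<le> L \<and> y i + h i \<le> H \<and> w i > 0 \<and> h i > 0"
    if "i \<in> {1..n}" for i
  proof -
    have "h i > 0" using assms(3) assms(9) that by force
    then show ?thesis
      using that feas assms(8) by (simp add: feasible_packing_def)
  qed
  have no: "\<not> rect_overlap w h x y i j" if "i \<in> {1..n}" "j \<in> {1..n}" "i \<noteq> j" for i j
    using that feas by (simp add: feasible_packing_def)
  have nested: "y i \<le> y j \<and> y j + h j \<le> y i + h i"
    if "i \<in> {1..n}" "j \<in> {1..n}" "h j \<le> h i" "y i < y j + h j" "y j < y i + h i" for i j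
  proof -
    have "h j dvd h i"
      using assms(9) that by (intro dvd_if_le_in_divisor_chain[OF assms(3,7)]) simp_all
    then show ?thesis
      using aligned_intervals_nested[of "h j" "h i" "y i" "y j"] that(4,5) bd[OF that(2)]
        hd[unfolded height_divisible_def, rule_format, OF that(1)]
        hd[unfolded height_divisible_def, rule_format, OF that(2)]
      by simp
  qed
  \<comment> \<open>Containment with equal heights means equal vertical ranges; the index then
    decides, which makes \<open>prec\<close> a strict order.\<close>
  define prec where "prec i j \<longleftrightarrow>
    y i \<le> y j \<and> y j + h j \<le> y i + h i \<and> (h i > h j \<or> h i = h j \<and> i < j)" for i j
  define P where "P j = {i \<in> {1..n}. prec i j}" for j
  define x' where "x' j = sum w (P j)" for j
  have prec_trans: "prec i k" if "prec i j" "prec j k" for i j k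
    using that unfolding prec_def by linarith
  have sum_insert: "sum w (insert j (P j)) = x' j + w j" for j
    by (simp add: x'_def P_def prec_def)
  have shift: "x' i + w i \<le> x' j" if ij: "i \<in> {1..n}" "prec i j" for i j
  proof -
    \<comment> \<open>By transitivity every predecessor of \<open>i\<close> precedes
      \<open>j\<close>, and so does \<open>i\<close> itself. Hence \<open>x' j\<close> already
      counts \<open>w i\<close> on top of \<open>x' i\<close>.\<close>
    have "insert i (P i) \<subseteq> P j"
      using ij prec_trans by (auto simp: P_def)
    then have "sum w (insert i (P i)) \<le> sum w (P j)"
      using bd by (intro sum_mono2) (auto simp: P_def less_imp_le)
    then show ?thesis
      using sum_insert by (simp add: x'_def)
  qed
  have fits: "x' j + w j \<le> L" if j: "j \<in> {1..n}" for j
  proof -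
    have meets_row: "i \<in> {1..n} \<and> y i \<le> y j \<and> y j < y i + h i" if "i \<in> insert j (P j)" for i
      using that j bd[of j] by (auto simp: P_def prec_def)
    have "sum w (insert j (P j)) \<le> L"
    proof (rule sum_width_disjoint_intervals_le[where x = x])
      show "L \<ge> 0" using bd[OF j] by linarith
      show "finite (insert j (P j))" by (simp add: P_def)
      show "0 \<le> x i \<and> 0 \<le> w i \<and> x i + w i \<le> L" if "i \<in> insert j (P j)" for i
        using bd meets_row[OF that] by (simp add: less_imp_le)
      \<comment> \<open>Both vertical ranges contain \<open>y j\<close>, so the vertical half of
        \<open>rect_overlap\<close> holds and the horizontal half must fail.\<close>
      show "x i + w i \<le> x k \<or> x k + w k \<le> x i"
        if "i \<in> insert j (P j)" "k \<in> insert j (P j)" "i \<noteq> k" for i k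
        using no[of i k] meets_row[OF that(1)] meets_row[OF that(2)] that(3)
        unfolding rect_overlap_def by linarith
    qed
    then show ?thesis by (simp add: sum_insert)
  qed
  have "x' j \<ge> 0" for j
    unfolding x'_def using bd by (intro sum_nonneg) (auto simp: P_def less_imp_le)
  moreover have "\<not> rect_overlap w h x' y i j"
    if ij: "i \<in> {1..n}" "j \<in> {1..n}" "i \<noteq> j" for i j
  proof
    assume ov: "rect_overlap w h x' y i j"
    then have meet: "y i < y j + h j" "y j < y i + h i"
      by (simp_all add: rect_overlap_def)
    have "prec i j \<or> prec j i"
    proof (cases "h j \<le> h i")
      case True
      then show ?thesis
        \<comment> \<open>For equal heights \<open>nested\<close> applies both ways, so the ranges
          agree and \<open>i\<close> \<noteq> \<open>j\<close> settles the order.\<close>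
        using nested[of i j] nested[of j i] meet ij unfolding prec_def by linarith
    next
      case False
      then show ?thesis
        using nested[of j i] meet ij unfolding prec_def by linarith
    qed
    then show False
      using shift[of i j] shift[of j i] ij ov unfolding rect_overlap_def by linarith
  qed
  ultimately have "feasible_packing n w h L H x' y"
    using fits bd by (simp add: feasible_packing_def)
  \<comment> \<open>The condition in \<open>canonical_form\<close> is the strict-height case of
    \<open>prec\<close>.\<close>
  moreover have "canonical_form n w h x' y"
    using shift by (auto simp: canonical_form_def prec_def)
  ultimately show ?thesis using hd by blast
qed

end
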